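(* Let $(F,G)$ be a Frobenius pair of functors, $F:\mathcal{C}\to\mathcal{D}$, $G:\mathcal{D}\to\mathcal{C}$, let $\eta:1_{\mathcal{C}}\to GF$ be the unit of the adjunction $(F,G)$ (with $F$ left adjoint to $G$) and let $\mu:GF\to1_{\mathcal{C}}$ be the counit of the adjunction $(G,F)$ (with $G$ left adjoint to $F$). Let $H:\mathcal{C}\to\mathcal{E}$ be a functor. Then $F$ is $H$-separable if and only if there exists a natural transformation $\beta:HG\to HG$ such that $$H(\mu_C)\circ\beta_{F(C)}\circ H(\eta_C)=I_{H(C)}$$ for all $C\in\mathcal{C}$.
   Context: A pair of functors $(F,G)$ is a Frobenius pair if $G$ is both a right adjoint and a left adjoint of $F$. For functors $F:\mathcal{C}\to\mathcal{D}$ and $H:\mathcal{C}\to\mathcal{E}$, $F$ is called $H$-separable if there is a family of maps $\mathcal{P}_{C,C'}:\mathrm{Hom}_{\mathcal{D}}(F(C),F(C'))\to\mathrm{Hom}_{\mathcal{E}}(H(C),H(C'))$, natural in $C,C'\in\mathcal{C}$ (i.e. $\mathcal{P}_{X,T}(F(v)\circ h\circ F(u))=H(v)\circ\mathcal{P}_{Y,Z}(h)\circ H(u)$ for all $u:X\to Y$, $v:Z\to T$ in $\mathcal{C}$ and $h:F(Y)\to F(Z)$ in $\mathcal{D}$), with $\mathcal{P}_{C,C'}(F(f))=H(f)$ for all $f:C\to C'$ in $\mathcal{C}$. *)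

theory Defs
  imports Main
begin

record ('o, 'a) category =
  obj :: "'o set"
  arr :: "'a set"
  dom :: "'a \<Rightarrow> 'o"
  cod :: "'a \<Rightarrow> 'o"
  ident :: "'o \<Rightarrow> 'a"
  comp :: "'a \<Rightarrow> 'a \<Rightarrow> 'a"  (infixr "\<odot>\<index>" 70)

text \<open>The composite \<open>g \<odot>\<^bsub>C\<^esub> f\<close> is ``\<open>g\<close> after \<open>f\<close>''.\<close>

definition hom :: "('o, 'a, 'm) category_scheme \<Rightarrow> 'o \<Rightarrow> 'o \<Rightarrow> 'a set"
  where "hom C X Y = {f \<in> arr C. dom C f = X \<and> cod C f = Y}"

locale category =
  fixes C (structure)
  assumes dom_obj: "f \<in> arr C \<Longrightarrow> dom C f \<in> obj C"
    and cod_obj: "f \<in> arr C \<Longrightarrow> cod C f \<in> obj C"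
    and ident_hom: "X \<in> obj C \<Longrightarrow> ident C X \<in> hom C X X"
    and comp_hom: "\<lbrakk>f \<in> hom C X Y; g \<in> hom C Y Z\<rbrakk> \<Longrightarrow> g \<odot> f \<in> hom C X Z"
    and comp_ident: "f \<in> hom C X Y \<Longrightarrow> f \<odot> ident C X = f"
    and ident_comp: "f \<in> hom C X Y \<Longrightarrow> ident C Y \<odot> f = f"
    and comp_assoc:
      "\<lbrakk>f \<in> hom C W X; g \<in> hom C X Y; h \<in> hom C Y Z\<rbrakk> \<Longrightarrow> (h \<odot> g) \<odot> f = h \<odot> (g \<odot> f)"

text \<open>All maps below (object and arrow parts of functors, components of natural
  transformations) are total HOL functions whose values outside the objects and arrows of the
  source category are irrelevant.\<close>

record ('o1, 'a1, 'o2, 'a2) func =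
  omap :: "'o1 \<Rightarrow> 'o2"
  amap :: "'a1 \<Rightarrow> 'a2"

locale is_functor = C: category C + D: category D
  for C :: "('o1, 'a1, 'm1) category_scheme"
    and D :: "('o2, 'a2, 'm2) category_scheme"
    and F :: "('o1, 'a1, 'o2, 'a2, 'm3) func_scheme" +
  assumes omap_obj: "X \<in> obj C \<Longrightarrow> omap F X \<in> obj D"
    and amap_hom: "f \<in> hom C X Y \<Longrightarrow> amap F f \<in> hom D (omap F X) (omap F Y)"
    and amap_ident: "X \<in> obj C \<Longrightarrow> amap F (ident C X) = ident D (omap F X)"
    and amap_comp:
      "\<lbrakk>f \<in> hom C X Y; g \<in> hom C Y Z\<rbrakk>
        \<Longrightarrow> amap F (g \<odot>\<^bsub>C\<^esub> f) = amap F g \<odot>\<^bsub>D\<^esub> amap F f"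

definition id_func :: "('o, 'a, 'o, 'a) func"
  where "id_func = \<lparr>omap = (\<lambda>X. X), amap = (\<lambda>f. f)\<rparr>"

definition comp_func ::
    "('o2, 'a2, 'o3, 'a3) func \<Rightarrow> ('o1, 'a1, 'o2, 'a2) func \<Rightarrow> ('o1, 'a1, 'o3, 'a3) func"
    (infixr "\<circ>\<^sub>F" 75)
  where "G \<circ>\<^sub>F F = \<lparr>omap = omap G \<circ> omap F, amap = amap G \<circ> amap F\<rparr>"

locale nat_trans = S: is_functor C D S + T: is_functor C D T
  for C :: "('o1, 'a1) category"
    and D :: "('o2, 'a2) category"
    and S T :: "('o1, 'a1, 'o2, 'a2) func"
    and \<tau> :: "'o1 \<Rightarrow> 'a2" +
  assumes component_hom: "X \<in> obj C \<Longrightarrow> \<tau> X \<in> hom D (omap S X) (omap T X)"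
    and naturality: "f \<in> hom C X Y \<Longrightarrow> amap T f \<odot>\<^bsub>D\<^esub> \<tau> X = \<tau> Y \<odot>\<^bsub>D\<^esub> amap S f"

text \<open>\<open>F\<close> is left adjoint to \<open>G\<close>, with unit \<open>\<eta> : 1 \<rightarrow> GF\<close> and counit \<open>\<epsilon> : FG \<rightarrow> 1\<close>.\<close>

locale adjunction =
    F: is_functor C D F + G: is_functor D C G +
    unit: nat_trans C C id_func "G \<circ>\<^sub>F F" \<eta> + counit: nat_trans D D "F \<circ>\<^sub>F G" id_func \<epsilon>
  for C :: "('o1, 'a1) category"
    and D :: "('o2, 'a2) category"
    and F :: "('o1, 'a1, 'o2, 'a2) func"
    and G :: "('o2, 'a2, 'o1, 'a1) func"
    and \<eta> :: "'o1 \<Rightarrow> 'a1"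
    and \<epsilon> :: "'o2 \<Rightarrow> 'a2" +
  assumes triangle_left:
      "X \<in> obj C \<Longrightarrow> \<epsilon> (omap F X) \<odot>\<^bsub>D\<^esub> amap F (\<eta> X) = ident D (omap F X)"
    and triangle_right:
      "Y \<in> obj D \<Longrightarrow> amap G (\<epsilon> Y) \<odot>\<^bsub>C\<^esub> \<eta> (omap G Y) = ident C (omap G Y)"

definition left_adjoint ::
    "('o1, 'a1) category \<Rightarrow> ('o2, 'a2) category
      \<Rightarrow> ('o1, 'a1, 'o2, 'a2) func \<Rightarrow> ('o2, 'a2, 'o1, 'a1) func \<Rightarrow> bool"
  where "left_adjoint C D F G \<longleftrightarrow> (\<exists>\<eta> \<epsilon>. adjunction C D F G \<eta> \<epsilon>)"

definition frobenius_pair ::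
    "('o1, 'a1) category \<Rightarrow> ('o2, 'a2) category
      \<Rightarrow> ('o1, 'a1, 'o2, 'a2) func \<Rightarrow> ('o2, 'a2, 'o1, 'a1) func \<Rightarrow> bool"
  where "frobenius_pair C D F G \<longleftrightarrow> left_adjoint C D F G \<and> left_adjoint D C G F"

definition H_separable ::
    "('o1, 'a1) category \<Rightarrow> ('o2, 'a2) category \<Rightarrow> ('o3, 'a3) category
      \<Rightarrow> ('o1, 'a1, 'o3, 'a3) func \<Rightarrow> ('o1, 'a1, 'o2, 'a2) func \<Rightarrow> bool"
  where "H_separable C D E H F \<longleftrightarrow>
    (\<exists>P :: 'o1 \<Rightarrow> 'o1 \<Rightarrow> 'a2 \<Rightarrow> 'a3.
      (\<forall>X\<in>obj C. \<forall>Y\<in>obj C. \<forall>h\<in>hom D (omap F X) (omap F Y).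
        P X Y h \<in> hom E (omap H X) (omap H Y)) \<and>
      (\<forall>X\<in>obj C. \<forall>Y\<in>obj C. \<forall>Z\<in>obj C. \<forall>T\<in>obj C.
        \<forall>u\<in>hom C X Y. \<forall>v\<in>hom C Z T. \<forall>h\<in>hom D (omap F Y) (omap F Z).
          P X T (amap F v \<odot>\<^bsub>D\<^esub> h \<odot>\<^bsub>D\<^esub> amap F u) =
            amap H v \<odot>\<^bsub>E\<^esub> P Y Z h \<odot>\<^bsub>E\<^esub> amap H u) \<and>
      (\<forall>X\<in>obj C. \<forall>Y\<in>obj C. \<forall>f\<in>hom C X Y. P X Y (amap F f) = amap H f))"

end

theory Submission
  imports Defs
begin

text \<open>
  Both directions come from the same picture: a functor \<open>F\<close> is \<open>H\<close>-separable as soon as \<open>H\<close> is a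
  natural retract of some functor \<open>K \<circ>\<^sub>F F\<close>, because \<open>h : F X \<rightarrow> F Y\<close> can then be sent to
  \<open>r\<^sub>Y \<odot> K h \<odot> i\<^sub>X\<close>, where \<open>i : H \<rightarrow> K F\<close> is the section and \<open>r : K F \<rightarrow> H\<close> the retraction
  (\<open>H_separable_if_retract\<close>). For a Frobenius pair, take \<open>K = H G\<close>: the unit \<open>\<eta>\<close> gives
  \<open>H \<eta> : H \<rightarrow> H G F\<close>, the counit \<open>\<mu>\<close> gives \<open>H \<mu> : H G F \<rightarrow> H\<close>, and the condition on \<open>\<beta>\<close> says
  precisely that \<open>H \<mu> \<odot> \<beta> F\<close> is a retraction of \<open>H \<eta>\<close>.

  Conversely, the other halves of the two adjunctions, \<open>\<epsilon> : F G \<rightarrow> 1\<close> and \<open>\<nu> : 1 \<rightarrow> F G\<close>, compose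
  to a natural endomorphism \<open>\<nu> \<odot> \<epsilon>\<close> of \<open>F G\<close>. A separating family \<open>P\<close> turns it into an
  endomorphism \<open>\<beta>\<^sub>Y = P (\<nu>\<^sub>Y \<odot> \<epsilon>\<^sub>Y)\<close> of \<open>H G\<close> (\<open>nat_trans_separating_image\<close>). Naturality of \<open>P\<close>
  moves \<open>H \<mu>\<close> and \<open>H \<eta>\<close> inside \<open>P\<close>, where the triangle identities \<open>F \<mu> \<odot> \<nu> F = 1\<close> and
  \<open>\<epsilon> F \<odot> F \<eta> = 1\<close> collapse everything to \<open>P 1 = 1\<close>.
\<close>

section \<open>Calculus of functors and natural transformations\<close>

lemma comp_func_simps [simp]:
  "omap (S \<circ>\<^sub>F T) X = omap S (omap T X)"
  "amap (S \<circ>\<^sub>F T) f = amap S (amap T f)"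
  by (simp_all add: comp_func_def)

lemma id_func_simps [simp]: "omap id_func X = X" "amap id_func f = f"
  by (simp_all add: id_func_def)

lemma comp_func_assoc: "(R \<circ>\<^sub>F S) \<circ>\<^sub>F T = R \<circ>\<^sub>F (S \<circ>\<^sub>F T)"
  by (simp add: comp_func_def comp_assoc)

lemma comp_func_id: "S \<circ>\<^sub>F id_func = S"
  by (cases S) (simp add: comp_func_def id_func_def fun_eq_iff)

lemma is_functor_comp:
  assumes "is_functor A B T" and "is_functor B D S"
  shows "is_functor A D (S \<circ>\<^sub>F T)"
proof -
  interpret T: is_functor A B T by fact
  interpret S: is_functor B D S by fact
  show ?thesis
  proof
    fix f g X Y Z assume f: "f \<in> hom A X Y" and g: "g \<in> hom A Y Z"
    show "amap (S \<circ>\<^sub>F T) (g \<odot>\<^bsub>A\<^esub> f) = amap (S \<circ>\<^sub>F T) g \<odot>\<^bsub>D\<^esub> amap (S \<circ>\<^sub>F T) f"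
      by (simp add: T.amap_comp [OF f g] S.amap_comp [OF T.amap_hom [OF f] T.amap_hom [OF g]])
  qed (simp_all add: T.omap_obj S.omap_obj T.amap_hom S.amap_hom T.amap_ident S.amap_ident)
qed

lemma (in category) hom_obj:
  assumes "f \<in> hom C X Y"
  shows "X \<in> obj C" and "Y \<in> obj C"
  using assms dom_obj cod_obj by (auto simp: hom_def)

lemma nat_trans_functor_image:
  assumes "nat_trans A B S T \<tau>" and "is_functor B D K"
  shows "nat_trans A D (K \<circ>\<^sub>F S) (K \<circ>\<^sub>F T) (\<lambda>X. amap K (\<tau> X))"
proof -
  interpret \<tau>: nat_trans A B S T \<tau> by fact
  interpret K: is_functor B D K by fact
  interpret KS: is_functor A D "K \<circ>\<^sub>F S" by (rule is_functor_comp) unfold_locales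
  interpret KT: is_functor A D "K \<circ>\<^sub>F T" by (rule is_functor_comp) unfold_locales
  show ?thesis
  proof
    fix f X Y assume f: "f \<in> hom A X Y"
    note X = \<tau>.S.C.hom_obj(1) [OF f] and Y = \<tau>.S.C.hom_obj(2) [OF f]
    have "amap K (amap T f) \<odot>\<^bsub>D\<^esub> amap K (\<tau> X) = amap K (amap T f \<odot>\<^bsub>B\<^esub> \<tau> X)"
      using K.amap_comp [OF \<tau>.component_hom [OF X] \<tau>.T.amap_hom [OF f]] by simp
    also have "\<dots> = amap K (\<tau> Y \<odot>\<^bsub>B\<^esub> amap S f)"
      by (simp add: \<tau>.naturality [OF f])
    also have "\<dots> = amap K (\<tau> Y) \<odot>\<^bsub>D\<^esub> amap K (amap S f)"
      by (rule K.amap_comp [OF \<tau>.S.amap_hom [OF f] \<tau>.component_hom [OF Y]])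
    finally show "amap (K \<circ>\<^sub>F T) f \<odot>\<^bsub>D\<^esub> amap K (\<tau> X) = amap K (\<tau> Y) \<odot>\<^bsub>D\<^esub> amap (K \<circ>\<^sub>F S) f"
      by simp
  qed (simp add: K.amap_hom \<tau>.component_hom)
qed

lemma nat_trans_precomp:
  assumes "nat_trans B D S T \<tau>" and "is_functor A B K"
  shows "nat_trans A D (S \<circ>\<^sub>F K) (T \<circ>\<^sub>F K) (\<lambda>X. \<tau> (omap K X))"
proof -
  interpret \<tau>: nat_trans B D S T \<tau> by fact
  interpret K: is_functor A B K by fact
  interpret SK: is_functor A D "S \<circ>\<^sub>F K" by (rule is_functor_comp) unfold_locales
  interpret TK: is_functor A D "T \<circ>\<^sub>F K" by (rule is_functor_comp) unfold_locales
  show ?thesis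
    by unfold_locales (simp_all add: K.omap_obj \<tau>.component_hom \<tau>.naturality [OF K.amap_hom])
qed

lemma nat_trans_vertical_comp:
  assumes "nat_trans A B R S \<sigma>" and "nat_trans A B S T \<tau>"
  shows "nat_trans A B R T (\<lambda>X. \<tau> X \<odot>\<^bsub>B\<^esub> \<sigma> X)"
proof -
  interpret \<sigma>: nat_trans A B R S \<sigma> by fact
  interpret \<tau>: nat_trans A B S T \<tau> by fact
  show ?thesis
  proof
    fix X assume "X \<in> obj A"
    then show "\<tau> X \<odot>\<^bsub>B\<^esub> \<sigma> X \<in> hom B (omap R X) (omap T X)"
      by (blast intro: \<sigma>.S.D.comp_hom \<sigma>.component_hom \<tau>.component_hom)
  next
    fix f X Y assume f: "f \<in> hom A X Y"
    note X = \<sigma>.S.C.hom_obj(1) [OF f] and Y = \<sigma>.S.C.hom_obj(2) [OF f]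
    note \<sigma>X = \<sigma>.component_hom [OF X] and \<sigma>Y = \<sigma>.component_hom [OF Y]
      and \<tau>X = \<tau>.component_hom [OF X] and \<tau>Y = \<tau>.component_hom [OF Y]
    have "amap T f \<odot>\<^bsub>B\<^esub> \<tau> X \<odot>\<^bsub>B\<^esub> \<sigma> X = (amap T f \<odot>\<^bsub>B\<^esub> \<tau> X) \<odot>\<^bsub>B\<^esub> \<sigma> X"
      using \<sigma>.S.D.comp_assoc [OF \<sigma>X \<tau>X \<tau>.T.amap_hom [OF f]] by simp
    also have "\<dots> = \<tau> Y \<odot>\<^bsub>B\<^esub> amap S f \<odot>\<^bsub>B\<^esub> \<sigma> X"
      using \<sigma>.S.D.comp_assoc [OF \<sigma>X \<sigma>.T.amap_hom [OF f] \<tau>Y] by (simp add: \<tau>.naturality [OF f])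
    also have "\<dots> = (\<tau> Y \<odot>\<^bsub>B\<^esub> \<sigma> Y) \<odot>\<^bsub>B\<^esub> amap R f"
      using \<sigma>.S.D.comp_assoc [OF \<sigma>.S.amap_hom [OF f] \<sigma>Y \<tau>Y] by (simp add: \<sigma>.naturality [OF f])
    finally show "amap T f \<odot>\<^bsub>B\<^esub> \<tau> X \<odot>\<^bsub>B\<^esub> \<sigma> X = (\<tau> Y \<odot>\<^bsub>B\<^esub> \<sigma> Y) \<odot>\<^bsub>B\<^esub> amap R f" .
  qed
qed

section \<open>Separability from a natural retraction\<close>

text \<open>The separating family is \<open>P h = r \<odot> K h \<odot> i\<close>. Its naturality is that of \<open>r\<close> and \<open>i\<close> together
  with functoriality of \<open>K\<close>; on an arrow \<open>F f\<close>, naturality of \<open>r\<close> pulls \<open>H f\<close> out and leaves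
  \<open>r \<odot> i = 1\<close>.\<close>

lemma H_separable_if_retract:
  fixes C :: "('o1, 'a1) category"
    and D :: "('o2, 'a2) category"
    and E :: "('o3, 'a3) category"
    and F :: "('o1, 'a1, 'o2, 'a2) func"
    and H :: "('o1, 'a1, 'o3, 'a3) func"
  assumes "is_functor C D F" and "is_functor D E K"
    and "nat_trans C E H (K \<circ>\<^sub>F F) i" and "nat_trans C E (K \<circ>\<^sub>F F) H r"
    and retract: "\<And>X. X \<in> obj C \<Longrightarrow> r X \<odot>\<^bsub>E\<^esub> i X = ident E (omap H X)"
  shows "H_separable C D E H F"
proof -
  interpret F: is_functor C D F by fact
  interpret K: is_functor D E K by fact
  interpret i: nat_trans C E H "K \<circ>\<^sub>F F" i by fact
  interpret r: nat_trans C E "K \<circ>\<^sub>F F" H r by fact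
  note assoc = K.D.comp_assoc
  define P where "P X Y h = r Y \<odot>\<^bsub>E\<^esub> amap K h \<odot>\<^bsub>E\<^esub> i X" for X Y h
  have i_hom: "i X \<in> hom E (omap H X) (omap K (omap F X))" if "X \<in> obj C" for X
    using i.component_hom [OF that] by simp
  have r_hom: "r X \<in> hom E (omap K (omap F X)) (omap H X)" if "X \<in> obj C" for X
    using r.component_hom [OF that] by simp
  have Ki_hom: "amap K h \<odot>\<^bsub>E\<^esub> i X \<in> hom E (omap H X) (omap K (omap F Y))"
    if "X \<in> obj C" "h \<in> hom D (omap F X) (omap F Y)" for X Y h
    by (rule K.D.comp_hom [OF i_hom [OF that(1)] K.amap_hom [OF that(2)]])
  have P_hom: "P X Y h \<in> hom E (omap H X) (omap H Y)"
    if "X \<in> obj C" "Y \<in> obj C" "h \<in> hom D (omap F X) (omap F Y)" for X Y h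
    unfolding P_def by (rule K.D.comp_hom [OF Ki_hom [OF that(1,3)] r_hom [OF that(2)]])
  have P_post: "P X T (amap F v \<odot>\<^bsub>D\<^esub> h) = amap H v \<odot>\<^bsub>E\<^esub> P X Z h"
    if X: "X \<in> obj C" and v: "v \<in> hom C Z T" and h: "h \<in> hom D (omap F X) (omap F Z)"
    for X Z T v h
  proof -
    note Z = F.C.hom_obj(1) [OF v] and T = F.C.hom_obj(2) [OF v]
    note Kv = K.amap_hom [OF F.amap_hom [OF v]]
    have "P X T (amap F v \<odot>\<^bsub>D\<^esub> h) = r T \<odot>\<^bsub>E\<^esub> amap K (amap F v) \<odot>\<^bsub>E\<^esub> amap K h \<odot>\<^bsub>E\<^esub> i X"
      by (simp add: P_def K.amap_comp [OF h F.amap_hom [OF v]]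
          assoc [OF i_hom [OF X] K.amap_hom [OF h] Kv])
    also have "\<dots> = (r T \<odot>\<^bsub>E\<^esub> amap K (amap F v)) \<odot>\<^bsub>E\<^esub> amap K h \<odot>\<^bsub>E\<^esub> i X"
      by (simp add: assoc [OF Ki_hom [OF X h] Kv r_hom [OF T]])
    also have "\<dots> = (amap H v \<odot>\<^bsub>E\<^esub> r Z) \<odot>\<^bsub>E\<^esub> amap K h \<odot>\<^bsub>E\<^esub> i X"
      using r.naturality [OF v] by simp
    also have "\<dots> = amap H v \<odot>\<^bsub>E\<^esub> P X Z h"
      by (simp add: P_def assoc [OF Ki_hom [OF X h] r_hom [OF Z] i.S.amap_hom [OF v]])
    finally show ?thesis .
  qed
  have P_pre: "P X Z (h \<odot>\<^bsub>D\<^esub> amap F u) = P Y Z h \<odot>\<^bsub>E\<^esub> amap H u"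
    if u: "u \<in> hom C X Y" and Z: "Z \<in> obj C" and h: "h \<in> hom D (omap F Y) (omap F Z)"
    for X Y Z u h
  proof -
    note X = F.C.hom_obj(1) [OF u] and Y = F.C.hom_obj(2) [OF u]
    note Ku = K.amap_hom [OF F.amap_hom [OF u]]
    have "P X Z (h \<odot>\<^bsub>D\<^esub> amap F u) = r Z \<odot>\<^bsub>E\<^esub> amap K h \<odot>\<^bsub>E\<^esub> amap K (amap F u) \<odot>\<^bsub>E\<^esub> i X"
      by (simp add: P_def K.amap_comp [OF F.amap_hom [OF u] h]
          assoc [OF i_hom [OF X] Ku K.amap_hom [OF h]])
    also have "\<dots> = r Z \<odot>\<^bsub>E\<^esub> amap K h \<odot>\<^bsub>E\<^esub> i Y \<odot>\<^bsub>E\<^esub> amap H u"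
      using i.naturality [OF u] by simp
    also have "\<dots> = P Y Z h \<odot>\<^bsub>E\<^esub> amap H u"
      by (simp add: P_def assoc [OF i.S.amap_hom [OF u] i_hom [OF Y] K.amap_hom [OF h]]
          assoc [OF i.S.amap_hom [OF u] Ki_hom [OF Y h] r_hom [OF Z]])
    finally show ?thesis .
  qed
  have P_nat: "P X T (amap F v \<odot>\<^bsub>D\<^esub> h \<odot>\<^bsub>D\<^esub> amap F u) = amap H v \<odot>\<^bsub>E\<^esub> P Y Z h \<odot>\<^bsub>E\<^esub> amap H u"
    if u: "u \<in> hom C X Y" and v: "v \<in> hom C Z T" and h: "h \<in> hom D (omap F Y) (omap F Z)"
    for X Y Z T u v h
    by (simp add: P_pre [OF u F.C.hom_obj(1) [OF v] h]
        P_post [OF F.C.hom_obj(1) [OF u] v F.D.comp_hom [OF F.amap_hom [OF u] h]])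
  have P_F: "P X Y (amap F f) = amap H f" if f: "f \<in> hom C X Y" for X Y f
  proof -
    note X = F.C.hom_obj(1) [OF f]
    have "P X Y (amap F f) = P X Y (amap F f \<odot>\<^bsub>D\<^esub> ident D (omap F X))"
      by (simp add: F.D.comp_ident [OF F.amap_hom [OF f]])
    also have "\<dots> = amap H f \<odot>\<^bsub>E\<^esub> P X X (ident D (omap F X))"
      by (rule P_post [OF X f F.D.ident_hom [OF F.omap_obj [OF X]]])
    also have "P X X (ident D (omap F X)) = ident E (omap H X)"
      using K.D.ident_comp [OF i_hom [OF X]]
      by (simp add: P_def K.amap_ident F.omap_obj X retract)
    also have "amap H f \<odot>\<^bsub>E\<^esub> \<dots> = amap H f"
      by (rule K.D.comp_ident [OF i.S.amap_hom [OF f]])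
    finally show ?thesis .
  qed
  show ?thesis
    unfolding H_separable_def using P_hom P_nat P_F by (intro exI [of _ P]) blast
qed

section \<open>Images of natural transformations under a separating family\<close>

text \<open>Unlike a functor, a separating family only transports arrows between objects in the image of
  \<open>F\<close>, and it need not respect composition. Its naturality still suffices to carry a
  transformation \<open>F S \<rightarrow> F T\<close> to one \<open>H S \<rightarrow> H T\<close>, because the sides of a naturality square of the
  former are arrows \<open>F (S f)\<close> and \<open>F (T f)\<close>.\<close>

lemma nat_trans_separating_image:
  assumes "is_functor C D F" and "is_functor C E H"
    and "is_functor B C S" and "is_functor B C T"
    and "nat_trans B D (F \<circ>\<^sub>F S) (F \<circ>\<^sub>F T) \<theta>"
    and P_hom: "\<And>X Y h. \<lbrakk>X \<in> obj C; Y \<in> obj C; h \<in> hom D (omap F X) (omap F Y)\<rbrakk>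
      \<Longrightarrow> P X Y h \<in> hom E (omap H X) (omap H Y)"
    and P_nat: "\<And>X Y Z W u v h.
      \<lbrakk>u \<in> hom C X Y; v \<in> hom C Z W; h \<in> hom D (omap F Y) (omap F Z)\<rbrakk>
      \<Longrightarrow> P X W (amap F v \<odot>\<^bsub>D\<^esub> h \<odot>\<^bsub>D\<^esub> amap F u) = amap H v \<odot>\<^bsub>E\<^esub> P Y Z h \<odot>\<^bsub>E\<^esub> amap H u"
  shows "nat_trans B E (H \<circ>\<^sub>F S) (H \<circ>\<^sub>F T) (\<lambda>Y. P (omap S Y) (omap T Y) (\<theta> Y))"
proof -
  interpret F: is_functor C D F by fact
  interpret H: is_functor C E H by fact
  interpret S: is_functor B C S by fact
  interpret T: is_functor B C T by fact
  interpret \<theta>: nat_trans B D "F \<circ>\<^sub>F S" "F \<circ>\<^sub>F T" \<theta> by fact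
  interpret HS: is_functor B E "H \<circ>\<^sub>F S" by (rule is_functor_comp) unfold_locales
  interpret HT: is_functor B E "H \<circ>\<^sub>F T" by (rule is_functor_comp) unfold_locales
  have \<theta>_hom: "\<theta> Y \<in> hom D (omap F (omap S Y)) (omap F (omap T Y))" if "Y \<in> obj B" for Y
    using \<theta>.component_hom [OF that] by simp
  have P\<theta>_hom: "P (omap S Y) (omap T Y) (\<theta> Y) \<in> hom E (omap H (omap S Y)) (omap H (omap T Y))"
    if "Y \<in> obj B" for Y
    by (rule P_hom [OF S.omap_obj [OF that] T.omap_obj [OF that] \<theta>_hom [OF that]])
  have P_post: "P X W (amap F v \<odot>\<^bsub>D\<^esub> h) = amap H v \<odot>\<^bsub>E\<^esub> P X Z h"
    if X: "X \<in> obj C" and v: "v \<in> hom C Z W" and h: "h \<in> hom D (omap F X) (omap F Z)"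
    for X Z W v h
    using P_nat [OF F.C.ident_hom [OF X] v h]
    by (simp add: F.amap_ident [OF X] H.amap_ident [OF X] F.D.comp_ident [OF h]
        H.D.comp_ident [OF P_hom [OF X F.C.hom_obj(1) [OF v] h]])
  have P_pre: "P X Z (h \<odot>\<^bsub>D\<^esub> amap F u) = P Y Z h \<odot>\<^bsub>E\<^esub> amap H u"
    if u: "u \<in> hom C X Y" and Z: "Z \<in> obj C" and h: "h \<in> hom D (omap F Y) (omap F Z)"
    for X Y Z u h
    using P_nat [OF u F.C.ident_hom [OF Z] h]
    by (simp add: F.amap_ident [OF Z] H.amap_ident [OF Z]
        F.D.ident_comp [OF F.D.comp_hom [OF F.amap_hom [OF u] h]]
        H.D.ident_comp [OF H.D.comp_hom [OF H.amap_hom [OF u] P_hom [OF F.C.hom_obj(2) [OF u] Z h]]])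
  show ?thesis
  proof
    fix f X Y assume f: "f \<in> hom B X Y"
    note X = S.C.hom_obj(1) [OF f] and Y = S.C.hom_obj(2) [OF f]
    have "amap H (amap T f) \<odot>\<^bsub>E\<^esub> P (omap S X) (omap T X) (\<theta> X)
        = P (omap S X) (omap T Y) (amap F (amap T f) \<odot>\<^bsub>D\<^esub> \<theta> X)"
      by (rule P_post [OF S.omap_obj [OF X] T.amap_hom [OF f] \<theta>_hom [OF X], symmetric])
    also have "amap F (amap T f) \<odot>\<^bsub>D\<^esub> \<theta> X = \<theta> Y \<odot>\<^bsub>D\<^esub> amap F (amap S f)"
      using \<theta>.naturality [OF f] by simp
    also have "P (omap S X) (omap T Y) \<dots> = P (omap S Y) (omap T Y) (\<theta> Y) \<odot>\<^bsub>E\<^esub> amap H (amap S f)"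
      by (rule P_pre [OF S.amap_hom [OF f] T.omap_obj [OF Y] \<theta>_hom [OF Y]])
    finally show "amap (H \<circ>\<^sub>F T) f \<odot>\<^bsub>E\<^esub> P (omap S X) (omap T X) (\<theta> X)
        = P (omap S Y) (omap T Y) (\<theta> Y) \<odot>\<^bsub>E\<^esub> amap (H \<circ>\<^sub>F S) f"
      by simp
  qed (simp add: P\<theta>_hom)
qed

section \<open>Frobenius pairs\<close>

theorem proposition3p9:
  fixes C :: "('o1, 'a1) category"
    and D :: "('o2, 'a2) category"
    and E :: "('o3, 'a3) category"
    and F :: "('o1, 'a1, 'o2, 'a2) func"
    and G :: "('o2, 'a2, 'o1, 'a1) func"
    and H :: "('o1, 'a1, 'o3, 'a3) func"
    and \<eta> \<mu> :: "'o1 \<Rightarrow> 'a1"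
    and \<epsilon> \<nu> :: "'o2 \<Rightarrow> 'a2"
  assumes "frobenius_pair C D F G"
    and "adjunction C D F G \<eta> \<epsilon>"
    and "adjunction D C G F \<nu> \<mu>"
    and "is_functor C E H"
  shows "H_separable C D E H F \<longleftrightarrow>
    (\<exists>\<beta>. nat_trans D E (H \<circ>\<^sub>F G) (H \<circ>\<^sub>F G) \<beta> \<and>
      (\<forall>X\<in>obj C. amap H (\<mu> X) \<odot>\<^bsub>E\<^esub> \<beta> (omap F X) \<odot>\<^bsub>E\<^esub> amap H (\<eta> X) = ident E (omap H X)))"
proof -
  interpret FG: adjunction C D F G \<eta> \<epsilon> by fact
  interpret GF: adjunction D C G F \<nu> \<mu> by fact
  interpret H: is_functor C E H by fact
  have HG: "is_functor D E (H \<circ>\<^sub>F G)"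
    by (rule is_functor_comp) unfold_locales
  have \<eta>_hom: "\<eta> X \<in> hom C X (omap G (omap F X))" if "X \<in> obj C" for X
    using FG.unit.component_hom [OF that] by simp
  have \<mu>_hom: "\<mu> X \<in> hom C (omap G (omap F X)) X" if "X \<in> obj C" for X
    using GF.counit.component_hom [OF that] by simp
  show ?thesis
  proof
    assume "H_separable C D E H F"
    then obtain P where
      P_hom': "\<forall>X\<in>obj C. \<forall>Y\<in>obj C. \<forall>h\<in>hom D (omap F X) (omap F Y).
        P X Y h \<in> hom E (omap H X) (omap H Y)" and
      P_nat': "\<forall>X\<in>obj C. \<forall>Y\<in>obj C. \<forall>Z\<in>obj C. \<forall>T\<in>obj C.
        \<forall>u\<in>hom C X Y. \<forall>v\<in>hom C Z T. \<forall>h\<in>hom D (omap F Y) (omap F Z).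
          P X T (amap F v \<odot>\<^bsub>D\<^esub> h \<odot>\<^bsub>D\<^esub> amap F u) =
            amap H v \<odot>\<^bsub>E\<^esub> P Y Z h \<odot>\<^bsub>E\<^esub> amap H u" and
      P_F: "\<forall>X\<in>obj C. \<forall>Y\<in>obj C. \<forall>f\<in>hom C X Y. P X Y (amap F f) = amap H f"
      unfolding H_separable_def by (elim exE conjE) (rule that)
    have P_hom: "P X Y h \<in> hom E (omap H X) (omap H Y)"
      if "X \<in> obj C" "Y \<in> obj C" "h \<in> hom D (omap F X) (omap F Y)" for X Y h
      using P_hom' that by blast
    have P_nat: "P X T (amap F v \<odot>\<^bsub>D\<^esub> h \<odot>\<^bsub>D\<^esub> amap F u) = amap H v \<odot>\<^bsub>E\<^esub> P Y Z h \<odot>\<^bsub>E\<^esub> amap H u"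
      if "u \<in> hom C X Y" "v \<in> hom C Z T" "h \<in> hom D (omap F Y) (omap F Z)" for X Y Z T u v h
      using P_nat' that FG.F.C.hom_obj by blast
    define \<theta> where "\<theta> Y = \<nu> Y \<odot>\<^bsub>D\<^esub> \<epsilon> Y" for Y
    have \<theta>: "nat_trans D D (F \<circ>\<^sub>F G) (F \<circ>\<^sub>F G) \<theta>"
      unfolding \<theta>_def
      by (rule nat_trans_vertical_comp [OF FG.counit.nat_trans_axioms GF.unit.nat_trans_axioms])
    define \<beta> where "\<beta> Y = P (omap G Y) (omap G Y) (\<theta> Y)" for Y
    have "nat_trans D E (H \<circ>\<^sub>F G) (H \<circ>\<^sub>F G) \<beta>"
      unfolding \<beta>_def
      by (rule nat_trans_separating_image [where P = P, OF FG.F.is_functor_axioms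
            H.is_functor_axioms FG.G.is_functor_axioms FG.G.is_functor_axioms \<theta> P_hom P_nat])
    moreover have "amap H (\<mu> X) \<odot>\<^bsub>E\<^esub> \<beta> (omap F X) \<odot>\<^bsub>E\<^esub> amap H (\<eta> X) = ident E (omap H X)"
      if X: "X \<in> obj C" for X
    proof -
      note FX = FG.F.omap_obj [OF X]
      have \<theta>_hom: "\<theta> (omap F X) \<in>
          hom D (omap F (omap G (omap F X))) (omap F (omap G (omap F X)))"
        using nat_trans.component_hom [OF \<theta> FX] by simp
      have \<epsilon>_hom: "\<epsilon> (omap F X) \<in> hom D (omap F (omap G (omap F X))) (omap F X)"
        using FG.counit.component_hom [OF FX] by simp
      have \<nu>_hom: "\<nu> (omap F X) \<in> hom D (omap F X) (omap F (omap G (omap F X)))"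
        using GF.unit.component_hom [OF FX] by simp
      have "amap H (\<mu> X) \<odot>\<^bsub>E\<^esub> \<beta> (omap F X) \<odot>\<^bsub>E\<^esub> amap H (\<eta> X)
          = P X X (amap F (\<mu> X) \<odot>\<^bsub>D\<^esub> \<theta> (omap F X) \<odot>\<^bsub>D\<^esub> amap F (\<eta> X))"
        unfolding \<beta>_def by (rule P_nat [OF \<eta>_hom [OF X] \<mu>_hom [OF X] \<theta>_hom, symmetric])
      also have "\<theta> (omap F X) \<odot>\<^bsub>D\<^esub> amap F (\<eta> X) = \<nu> (omap F X)"
        by (simp add: \<theta>_def FG.triangle_left X FG.F.D.comp_ident [OF \<nu>_hom]
            FG.F.D.comp_assoc [OF FG.F.amap_hom [OF \<eta>_hom [OF X]] \<epsilon>_hom \<nu>_hom])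
      also have "amap F (\<mu> X) \<odot>\<^bsub>D\<^esub> \<nu> (omap F X) = amap F (ident C X)"
        by (simp add: GF.triangle_right X FG.F.amap_ident)
      also have "P X X \<dots> = ident E (omap H X)"
        by (simp add: P_F X FG.F.C.ident_hom H.amap_ident)
      finally show ?thesis .
    qed
    ultimately show "\<exists>\<beta>. nat_trans D E (H \<circ>\<^sub>F G) (H \<circ>\<^sub>F G) \<beta> \<and> (\<forall>X\<in>obj C.
        amap H (\<mu> X) \<odot>\<^bsub>E\<^esub> \<beta> (omap F X) \<odot>\<^bsub>E\<^esub> amap H (\<eta> X) = ident E (omap H X))"
      by blast
  next
    assume "\<exists>\<beta>. nat_trans D E (H \<circ>\<^sub>F G) (H \<circ>\<^sub>F G) \<beta> \<and> (\<forall>X\<in>obj C.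
        amap H (\<mu> X) \<odot>\<^bsub>E\<^esub> \<beta> (omap F X) \<odot>\<^bsub>E\<^esub> amap H (\<eta> X) = ident E (omap H X))"
    then obtain \<beta> where \<beta>: "nat_trans D E (H \<circ>\<^sub>F G) (H \<circ>\<^sub>F G) \<beta>"
      and split: "\<And>X. X \<in> obj C \<Longrightarrow>
        amap H (\<mu> X) \<odot>\<^bsub>E\<^esub> \<beta> (omap F X) \<odot>\<^bsub>E\<^esub> amap H (\<eta> X) = ident E (omap H X)"
      by blast
    have H\<eta>: "nat_trans C E H ((H \<circ>\<^sub>F G) \<circ>\<^sub>F F) (\<lambda>X. amap H (\<eta> X))"
      using nat_trans_functor_image [OF FG.unit.nat_trans_axioms H.is_functor_axioms]
      by (simp only: comp_func_assoc comp_func_id)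
    have H\<mu>: "nat_trans C E ((H \<circ>\<^sub>F G) \<circ>\<^sub>F F) H (\<lambda>X. amap H (\<mu> X))"
      using nat_trans_functor_image [OF GF.counit.nat_trans_axioms H.is_functor_axioms]
      by (simp only: comp_func_assoc comp_func_id)
    have r: "nat_trans C E ((H \<circ>\<^sub>F G) \<circ>\<^sub>F F) H (\<lambda>X. amap H (\<mu> X) \<odot>\<^bsub>E\<^esub> \<beta> (omap F X))"
      by (rule nat_trans_vertical_comp [OF nat_trans_precomp [OF \<beta> FG.F.is_functor_axioms] H\<mu>])
    show "H_separable C D E H F"
    proof (rule H_separable_if_retract [OF FG.F.is_functor_axioms HG H\<eta> r])
      fix X assume X: "X \<in> obj C"
      have \<beta>_hom: "\<beta> (omap F X) \<in>
          hom E (omap H (omap G (omap F X))) (omap H (omap G (omap F X)))"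
        using nat_trans.component_hom [OF \<beta> FG.F.omap_obj [OF X]] by simp
      show "(amap H (\<mu> X) \<odot>\<^bsub>E\<^esub> \<beta> (omap F X)) \<odot>\<^bsub>E\<^esub> amap H (\<eta> X) = ident E (omap H X)"
        using H.D.comp_assoc [OF H.amap_hom [OF \<eta>_hom [OF X]] \<beta>_hom H.amap_hom [OF \<mu>_hom [OF X]]]
          split [OF X] by simp
    qed
  qed
qed

end
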